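(* Let $\Phi$ be the root system of type $A_n$ with simple system $\Delta=\{\alpha_1,\dots,\alpha_n\}$, and let $\Delta_2=\bigcup_{i=1}^m\Delta_{2,i}\subset\Delta$, where $\Delta_{2,i}=\{\alpha_{p_i},\alpha_{p_i+1},\dots,\alpha_{p_i+t_i}\}$ and $|p_i+t_i-p_{i'}|\ge 2$ for $i\ne i'$ (i.e. the root subsystems $\Phi_{\Delta_{2,i}}$ are pairwise disjoint and their union is $\Phi_{\Delta_2}$). (1) The biclosed sets in $\Phi^+_{\emptyset,\Delta_2}$ are in bijection with the quasitrivial semigroup structures on $X_{n+1}=\{1,\dots,n+1\}$ with the property that each equivalence class induced by the quasitrivial semigroup structure is contained in the set $\{p_i,p_i+1,\dots,p_i+t_i+1\}$ for some $i$, $1\le i\le m$. (2) Let $(X_{n+1},F)$ be a quasitrivial semigroup with the property described in (1). Then the corresponding biclosed set $C$ in $\Phi^+_{\emptyset,\Delta_2}$ can be constructed as follows (for $1\le j\le k\le n$): (a) $\{\alpha_{j,k+1},-\alpha_{j,k+1}\}\cap C=\emptyset$ if $F(j,k+1)=j$, $F(k+1,j)=k+1$. (b) $\alpha_{j,k+1}\in C$ and $-\alpha_{j,k+1}\notin C$ if $F(j,k+1)=F(k+1,j)=k+1$. (c) $-\alpha_{j,k+1}\in C$ and $\alpha_{j,k+1}\notin C$ if $F(j,k+1)=F(k+1,j)=j$ and $j,k+1\in\{p_i,p_i+1,\dots,p_i+t_i+1\}$ for some $i$, $1\le i\le m$. (d) $\{\alpha_{j,k+1},-\alpha_{j,k+1}\}\subset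 C$ if $F(j,k+1)=k+1$, $F(k+1,j)=j$. (e) $\{\alpha_{j,k+1},-\alpha_{j,k+1}\}\cap C=\emptyset$ if $F(j,k+1)=F(k+1,j)=j$ and there does not exist $i$, $1\le i\le m$, such that $j,k+1\in\{p_i,p_i+1,\dots,p_i+t_i+1\}$.
   Context: Root system of type $A_n$: $V$ is a real vector space with basis $\alpha_1,\dots,\alpha_n$, $\Phi=\{\pm(\alpha_i+\cdots+\alpha_k):1\le i\le k\le n\}$, with standard positive system $\Phi^+=\{\alpha_i+\cdots+\alpha_k:1\le i\le k\le n\}$. For $1\le j\le k\le n$, $\alpha_{j,k+1}:=\alpha_j+\cdots+\alpha_k$. For $\Delta'\subset\Delta$, $\Phi_{\Delta'}=\mathrm{span}_{\mathbb R}(\Delta')\cap\Phi$, and $\Phi^+_{\emptyset,\Delta'}=\Phi^+\cup\Phi_{\Delta'}$ is called a standard parabolic subset. A subset $C\subset\Phi$ is closed if $\alpha,\beta\in C$ and $\alpha+\beta\in\Phi$ imply $\alpha+\beta\in C$. For $D\subset\Phi$, a biclosed set in $D$ is a closed set $B\subset D$ such that $D\setminus B$ is closed. A quasitrivial semigroup structure on $X$ is an associative $F:X\times X\to X$ with $F(a,b)\in\{a,b\}$ for all $a,b\in X$. Such an $F$ is equivalent to the data of a total preorder $\precsim$ on $X$ (a total, transitive relation; $x\sim y$ means $x\precsim y$ and $y\precsim x$) such that $F(x,y)$ is the $\precsim$-maximum of $x,y$ if $x\nsim y$, and on each equivalence class of $\sim$ the map $F$ restricts to one of the projections $\pi_1,\pi_2$,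 where $\pi_i(a_1,a_2)=a_i$. The equivalence classes of $\sim$ are the equivalence classes induced by the quasitrivial semigroup structure.
   Formalization: Only equivalence classes with at least two elements are required to lie in some {p_i,…,p_i+t_i+1}; singleton classes are always allowed, since otherwise the claim fails whenever these sets do not cover {1,…,n+1}. *)

theory Defs
  imports Complex_Main "HOL-Library.FuncSet"
begin

text \<open>
  The simple roots are a family \<open>\<alpha>\<close> of which only the values on \<open>{1..n}\<close> matter.
  Here \<open>root_between \<alpha> j k\<close> is the root written with two subscripts, \<open>\<alpha>\<^sub>j\<^sub>,\<^sub>k\<close>,
  which does \<^emph>\<open>not\<close> include the simple root with index \<open>k\<close>.
\<close>

definition root_between :: "(nat \<Rightarrow> 'v::real_vector) \<Rightarrow> nat \<Rightarrow> nat \<Rightarrow> 'v" where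
  "root_between \<alpha> j k = (\<Sum>i=j..<k. \<alpha> i)"

definition pos_roots :: "(nat \<Rightarrow> 'v::real_vector) \<Rightarrow> nat \<Rightarrow> 'v set" where
  "pos_roots \<alpha> n = {root_between \<alpha> i (k + 1) | i k. 1 \<le> i \<and> i \<le> k \<and> k \<le> n}"

definition root_system_A :: "(nat \<Rightarrow> 'v::real_vector) \<Rightarrow> nat \<Rightarrow> 'v set" where
  "root_system_A \<alpha> n = pos_roots \<alpha> n \<union> uminus ` pos_roots \<alpha> n"

definition subsystem :: "(nat \<Rightarrow> 'v::real_vector) \<Rightarrow> nat \<Rightarrow> 'v set \<Rightarrow> 'v set" where
  "subsystem \<alpha> n D = span D \<inter> root_system_A \<alpha> n"

definition std_parabolic :: "(nat \<Rightarrow> 'v::real_vector) \<Rightarrow> nat \<Rightarrow> 'v set \<Rightarrow> 'v set" where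
  "std_parabolic \<alpha> n D = pos_roots \<alpha> n \<union> subsystem \<alpha> n D"

definition closed_roots :: "'v::real_vector set \<Rightarrow> 'v set \<Rightarrow> bool" where
  "closed_roots \<Phi> C \<longleftrightarrow> C \<subseteq> \<Phi> \<and> (\<forall>x\<in>C. \<forall>y\<in>C. x + y \<in> \<Phi> \<longrightarrow> x + y \<in> C)"

definition biclosed_in :: "'v::real_vector set \<Rightarrow> 'v set \<Rightarrow> 'v set \<Rightarrow> bool" where
  "biclosed_in \<Phi> D B \<longleftrightarrow> B \<subseteq> D \<and> closed_roots \<Phi> B \<and> closed_roots \<Phi> (D - B)"

text \<open>
  Operations are taken extensional, so that distinct HOL functions are distinct operations
  on \<open>X\<close>.
\<close>

definition quasitrivial_semigroups :: "'a set \<Rightarrow> ('a \<times> 'a \<Rightarrow> 'a) set" where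
  "quasitrivial_semigroups X =
    {F \<in> X \<times> X \<rightarrow>\<^sub>E X.
      (\<forall>a\<in>X. \<forall>b\<in>X. \<forall>c\<in>X. F (F (a, b), c) = F (a, F (b, c))) \<and>
      (\<forall>a\<in>X. \<forall>b\<in>X. F (a, b) \<in> {a, b})}"

definition represents :: "'a set \<Rightarrow> ('a \<times> 'a \<Rightarrow> 'a) \<Rightarrow> 'a rel \<Rightarrow> bool" where
  "represents X F R \<longleftrightarrow>
    preorder_on X R \<and> total_on X R \<and>
    (\<forall>x\<in>X. \<forall>y\<in>X. (x, y) \<in> R \<and> (y, x) \<notin> R \<longrightarrow> F (x, y) = y \<and> F (y, x) = y) \<and>
    (\<forall>E \<in> X // (R \<inter> R\<inverse>).
      (\<forall>x\<in>E. \<forall>y\<in>E. F (x, y) = x) \<or> (\<forall>x\<in>E. \<forall>y\<in>E. F (x, y) = y))"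

definition qt_preorder :: "'a set \<Rightarrow> ('a \<times> 'a \<Rightarrow> 'a) \<Rightarrow> 'a rel" where
  "qt_preorder X F = (THE R. represents X F R)"

definition qt_classes :: "'a set \<Rightarrow> ('a \<times> 'a \<Rightarrow> 'a) \<Rightarrow> 'a set set" where
  "qt_classes X F = X // (qt_preorder X F \<inter> (qt_preorder X F)\<inverse>)"

text \<open>For a quasitrivial semigroup, the relation described in \<^const>\<open>qt_preorder\<close> exists and is unique:\<close>

lemma represents_unique:
  assumes R: "represents X F R"
  shows "R = {(x, y) \<in> X \<times> X. F (x, y) = y \<or> F (y, x) = y}"
proof -
  have sub: "R \<subseteq> X \<times> X" and re: "\<And>x. x \<in> X \<Longrightarrow> (x, x) \<in> R" and tr: "trans R"
    and tot: "total_on X R"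
    using R by (auto simp: represents_def preorder_on_def refl_on_def)
  have mx: "F (x, y) = y \<and> F (y, x) = y" if "x \<in> X" "y \<in> X" "(x, y) \<in> R" "(y, x) \<notin> R" for x y
    using R that unfolding represents_def by blast
  have cl: "F (x, y) = x \<and> F (y, x) = y \<or> F (x, y) = y \<and> F (y, x) = x"
    if "(x, y) \<in> R" "(y, x) \<in> R" for x y
  proof -
    have x: "x \<in> X" using that sub by auto
    let ?E = "(R \<inter> R\<inverse>) `` {x}"
    have "\<forall>E \<in> X // (R \<inter> R\<inverse>).
        (\<forall>x\<in>E. \<forall>y\<in>E. F (x, y) = x) \<or> (\<forall>x\<in>E. \<forall>y\<in>E. F (x, y) = y)"
      using R by (simp add: represents_def)
    then have "(\<forall>x\<in>?E. \<forall>y\<in>?E. F (x, y) = x) \<or> (\<forall>x\<in>?E. \<forall>y\<in>?E. F (x, y) = y)"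
      using quotientI[OF x] by (rule bspec)
    moreover have "x \<in> ?E" "y \<in> ?E" using that re x by auto
    ultimately show ?thesis by (elim disjE) simp_all
  qed
  have "(x, y) \<in> R \<longleftrightarrow> F (x, y) = y \<or> F (y, x) = y" if "x \<in> X" "y \<in> X" for x y
    using cl[of x y] mx[of x y] mx[of y x] re[of x] tot that unfolding total_on_def by metis
  then show ?thesis using sub by auto
qed

lemma represents_exists:
  assumes F: "F \<in> quasitrivial_semigroups X"
  shows "represents X F {(x, y) \<in> X \<times> X. F (x, y) = y \<or> F (y, x) = y}"
    (is "represents X F ?R")
proof -
  have as: "F (F (a, b), c) = F (a, F (b, c))" if "a \<in> X" "b \<in> X" "c \<in> X" for a b c
    using F that by (auto simp: quasitrivial_semigroups_def)
  have qt: "F (a, b) = a \<or> F (a, b) = b" if "a \<in> X" "b \<in> X" for a b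
    using F that by (auto simp: quasitrivial_semigroups_def)
  have sim: "(x, y) \<in> ?R \<inter> ?R\<inverse> \<longleftrightarrow> x \<in> X \<and> y \<in> X \<and> (x = y \<or> F (x, y) \<noteq> F (y, x))" for x y
    using qt[of x y] qt[of y x] by auto
  have tr: "trans ?R"
  proof (rule transI)
    fix x y z assume "(x, y) \<in> ?R" "(y, z) \<in> ?R"
    then have X: "x \<in> X" "y \<in> X" "z \<in> X"
      and 1: "F (x, y) = y \<or> F (y, x) = y" and 2: "F (y, z) = z \<or> F (z, y) = z" by auto
    have "F (x, z) = z \<or> F (z, x) = z"
      using 1 2 as[of x y z] as[of z y x] as[of z x y] as[of y x z] qt[of x z] qt[of z x] X
      by metis
    then show "(x, z) \<in> ?R" using X by auto
  qed
  have three: "F (x, z) = x \<and> F (z, x) = z"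
    if "x \<in> X" "y \<in> X" "z \<in> X" "F (x, y) = x" "F (y, x) = y" "(x, z) \<in> ?R \<inter> ?R\<inverse>" "x \<noteq> y" for x y z
  proof (rule ccontr)
    assume neg: "\<not> ?thesis"
    then have xz: "F (x, z) = z" "F (z, x) = x"
      using that(6) sim[of x z] qt[of x z] qt[of z x] that(1,3) by auto
    have "x \<noteq> z" using neg xz by auto
    have "F (F (y, z), x) = y" using as[of y z x] that xz by simp
    then have "F (y, z) = y" using qt[of y z] that xz by auto
    then have "z = x" using as[of x y z] that xz by simp
    then show False using \<open>x \<noteq> z\<close> by simp
  qed
  have "(\<forall>x\<in>E. \<forall>y\<in>E. F (x, y) = x) \<or> (\<forall>x\<in>E. \<forall>y\<in>E. F (x, y) = y)"
    if "E \<in> X // (?R \<inter> ?R\<inverse>)" for E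
  proof -
    have E: "(x, y) \<in> ?R \<inter> ?R\<inverse>" if "x \<in> E" "y \<in> E" for x y
    proof -
      obtain a where "E = (?R \<inter> ?R\<inverse>) `` {a}" using \<open>E \<in> _\<close> by (rule quotientE)
      then have "(x, a) \<in> ?R" "(a, x) \<in> ?R" "(a, y) \<in> ?R" "(y, a) \<in> ?R" using that by auto
      then show ?thesis using tr unfolding trans_def by blast
    qed
    have EX: "x \<in> X" if "x \<in> E" for x using E[OF that that] by auto
    have left: "F (u, v) = u" if "x \<in> E" "y \<in> E" "x \<noteq> y" "F (x, y) = x" "u \<in> E" "v \<in> E" for x y u v
    proof -
      have yx: "F (y, x) = y"
        using E[OF that(1,2)] sim[of x y] qt[of y x] that EX by metis
      have *: "F (x, w) = x \<and> F (w, x) = w" if "w \<in> E" for w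
        using three[of x y w] E[of x w] EX that \<open>x \<in> E\<close> \<open>y \<in> E\<close> \<open>F (x, y) = x\<close> yx \<open>x \<noteq> y\<close> by blast
      show ?thesis
      proof (cases "u = x")
        case True then show ?thesis using * that by blast
      next
        case False
        then show ?thesis using three[of u x v] *[of u] E[of u v] EX that by blast
      qed
    qed
    show ?thesis
      using left qt EX by metis
  qed
  moreover have "preorder_on X ?R"
    using tr qt by (auto simp: preorder_on_def refl_on_def)
  moreover have "total_on X ?R"
    using qt by (auto simp: total_on_def)
  moreover have "F (x, y) = y \<and> F (y, x) = y"
    if "x \<in> X" "y \<in> X" "(x, y) \<in> ?R" "(y, x) \<notin> ?R" for x y
    using that qt[of x y] qt[of y x] by auto
  ultimately show ?thesis unfolding represents_def by blast
qed

lemma qt_preorder_represents: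
  assumes "F \<in> quasitrivial_semigroups X"
  shows "represents X F (qt_preorder X F)"
proof -
  have "\<exists>!R. represents X F R"
  proof (rule ex1I)
    show "represents X F {(x, y) \<in> X \<times> X. F (x, y) = y \<or> F (y, x) = y}"
      using assms by (rule represents_exists)
    show "R = {(x, y) \<in> X \<times> X. F (x, y) = y \<or> F (y, x) = y}" if "represents X F R" for R
      using that by (rule represents_unique)
  qed
  then show ?thesis unfolding qt_preorder_def by (rule theI')
qed

text \<open>
  Only classes with at least two elements are constrained: a singleton class is always allowed,
  also outside every block.  (For \<open>m = 0\<close> these are exactly the total orders on \<open>{1..n + 1}\<close>,
  matching the biclosed subsets of the positive system.)
\<close>

definition block_quasitrivial_semigroups ::
  "nat \<Rightarrow> nat \<Rightarrow> (nat \<Rightarrow> nat) \<Rightarrow> (nat \<Rightarrow> nat) \<Rightarrow> (nat \<times> nat \<Rightarrow> nat) set" where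
  "block_quasitrivial_semigroups n m p t =
    {F \<in> quasitrivial_semigroups {1..n + 1}.
      \<forall>E \<in> qt_classes {1..n + 1} F. \<not> is_singleton E \<longrightarrow>
        (\<exists>i\<in>{1..m}. E \<subseteq> {p i..p i + t i + 1})}"

end

theory Submission
  imports Defs
begin

text \<open>
  Every root is a difference \<open>\<epsilon> b - \<epsilon> a\<close> of two points with \<open>a \<noteq> b\<close> in \<open>{1..n + 1}\<close>, so sets of
  roots become irreflexive relations, and a set of roots is closed iff its relation is transitive
  away from the diagonal.  The parabolic subset becomes a total preorder \<open>D\<close>.  A quasitrivial
  operation \<open>F\<close> is determined by the relation \<open>F (x, y) = y\<close> on distinct pairs, and it is
  associative iff this relation and its complement are both transitive away from the diagonal.
  If \<open>F\<close> is commutative outside the equivalence classes of \<open>D\<close>, the relation is determined by its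
  restriction to \<open>D\<close>, and totality of \<open>D\<close> makes the extension from \<open>D\<close> preserve both conditions.
\<close>

section \<open>Quasitrivial operations and biclosed relations\<close>

definition biclosed_rel :: "'a rel \<Rightarrow> 'a rel \<Rightarrow> bool" where
  "biclosed_rel D B \<longleftrightarrow> B \<subseteq> D - Id \<and> trans (B\<^sup>=) \<and> trans ((D - B)\<^sup>=)"

definition right_rel :: "'a rel \<Rightarrow> ('a \<times> 'a \<Rightarrow> 'a) \<Rightarrow> 'a rel" where
  "right_rel D F = {(x, y) \<in> D. x \<noteq> y \<and> F (x, y) = y}"

text \<open>The inverse of \<open>right_rel D\<close> on \<open>commutes_outside X D\<close>. On a
  pair in \<open>D\<close> the relation \<open>B\<close> decides. If \<open>(x, y)\<close> is not in
  \<open>D\<close>, commutativity forces the value of the reversed pair, which lies in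
  \<open>D\<close> by totality: that value is \<open>x\<close> if \<open>(y, x)\<close> is in
  \<open>B\<close>, and \<open>y\<close> otherwise.\<close>

definition rel_op :: "'a set \<Rightarrow> 'a rel \<Rightarrow> 'a rel \<Rightarrow> 'a \<times> 'a \<Rightarrow> 'a" where
  "rel_op X D B = (\<lambda>(x, y)\<in>X \<times> X.
     if (x, y) \<in> B \<or> (x, y) \<notin> D \<and> (y, x) \<notin> B then y else x)"

definition commutes_outside :: "'a set \<Rightarrow> 'a rel \<Rightarrow> ('a \<times> 'a \<Rightarrow> 'a) set" where
  "commutes_outside X D = {F \<in> quasitrivial_semigroups X.
     \<forall>x\<in>X. \<forall>y\<in>X. F (x, y) \<noteq> F (y, x) \<longrightarrow> (x, y) \<in> D \<and> (y, x) \<in> D}"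

text \<open>Both halves come from evaluating \<open>F (F (x, y), z) = F (x, F (y, z))\<close>. If
  \<open>F\<close> picks the right entry on \<open>(x, y)\<close> and \<open>(y, z)\<close>, the two
  sides are \<open>z\<close> and \<open>F (x, z)\<close>; if it picks the left entry on both, they
  are \<open>F (x, z)\<close> and \<open>x\<close>.\<close>

lemma biclosed_right_rel:
  assumes F: "F \<in> quasitrivial_semigroups X" and D: "D \<subseteq> X \<times> X" "trans D"
  shows "biclosed_rel D (right_rel D F)"
proof -
  have as: "F (F (a, b), c) = F (a, F (b, c))" if "a \<in> X" "b \<in> X" "c \<in> X" for a b c
    using F that by (auto simp: quasitrivial_semigroups_def)
  have qt: "F (a, b) = a \<or> F (a, b) = b" if "a \<in> X" "b \<in> X" for a b
    using F that by (auto simp: quasitrivial_semigroups_def)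
  have DX: "a \<in> X" "b \<in> X" if "(a, b) \<in> D" for a b
    using D(1) that by auto
  have tr: "(a, c) \<in> D" if "(a, b) \<in> D" "(b, c) \<in> D" for a b c
    using D(2) that unfolding trans_def by blast
  have 1: "F (x, z) = z" if "x \<in> X" "y \<in> X" "z \<in> X" "F (x, y) = y" "F (y, z) = z" for x y z
    using as[of x y z] that by simp
  have 2: "F (x, z) = x" if "x \<in> X" "y \<in> X" "z \<in> X" "F (x, y) = x" "F (y, z) = y" for x y z
    using as[of x y z] that by simp
  have "(x, z) \<in> (right_rel D F)\<^sup>=" if "(x, y) \<in> (right_rel D F)\<^sup>=" "(y, z) \<in> (right_rel D F)\<^sup>="
    for x y z
    using that 1[of x y z] tr[of x y z] DX[of x y] DX[of y z] by (auto simp: right_rel_def)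
  moreover have "(x, z) \<in> (D - right_rel D F)\<^sup>="
    if "(x, y) \<in> (D - right_rel D F)\<^sup>=" "(y, z) \<in> (D - right_rel D F)\<^sup>=" for x y z
    using that 2[of x y z] tr[of x y z] DX[of x y] DX[of y z] qt[of x y] qt[of y z]
    by (auto simp: right_rel_def)
  ultimately show ?thesis
    unfolding biclosed_rel_def trans_def by (auto simp: right_rel_def)
qed

lemma rel_op_commutes_outside:
  assumes B: "biclosed_rel D B"
    and D: "D \<subseteq> X \<times> X" "trans D" "\<And>x y. x \<in> X \<Longrightarrow> y \<in> X \<Longrightarrow> (x, y) \<in> D \<or> (y, x) \<in> D"
  shows "rel_op X D B \<in> commutes_outside X D"
proof -
  \<comment> \<open>\<open>T x y\<close> is the extension of \<open>B\<close> from \<open>D\<close>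
    to all pairs: for distinct \<open>x\<close> and \<open>y\<close> it says that the operation
    takes the value \<open>y\<close> at \<open>(x, y)\<close>.\<close>
  define T where "T x y \<longleftrightarrow> (x, y) \<in> B \<or> (x, y) \<notin> D \<and> (y, x) \<notin> B" for x y
  have sub: "(x, y) \<in> D" "x \<noteq> y" if "(x, y) \<in> B" for x y
    using B that by (auto simp: biclosed_rel_def)
  have B1: "(x, z) \<in> B" if "(x, y) \<in> B" "(y, z) \<in> B" "x \<noteq> z" for x y z
    using B that unfolding biclosed_rel_def trans_def by blast
  have B2: "(x, z) \<notin> B" if "(x, y) \<in> D" "(x, y) \<notin> B" "(y, z) \<in> D" "(y, z) \<notin> B" "x \<noteq> z" for x y z
    using B that unfolding biclosed_rel_def trans_def by blast
  have tr: "(x, z) \<in> D" if "(x, y) \<in> D" "(y, z) \<in> D" for x y z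
    using D(2) that unfolding trans_def by blast
  \<comment> \<open>Replace each pair outside \<open>D\<close> by its reverse, which totality puts
    in \<open>D\<close>. If the claim failed, each of the three resulting pairs would be known to
    lie in \<open>B\<close> or in \<open>D - B\<close>. Then \<open>B1\<close> or \<open>B2\<close>
    composes two of them and contradicts the third, or transitivity puts a pair into
    \<open>D\<close> that was assumed outside.\<close>
  have T1: "T x z" if "x \<in> X" "y \<in> X" "z \<in> X" "x \<noteq> y" "y \<noteq> z" "x \<noteq> z" "T x y" "T y z" for x y z
    using that D(3)[of x y] D(3)[of y z] D(3)[of x z] B1[of x y z] B1[of z x y] B1[of y z x]
      B2[of z y x] B2[of x z y] B2[of y x z] tr[of z y x] tr[of x z y] tr[of y x z] sub(1)
    unfolding T_def by blast
  have T2: "\<not> T x z"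
    if "x \<in> X" "y \<in> X" "z \<in> X" "x \<noteq> y" "y \<noteq> z" "x \<noteq> z" "\<not> T x y" "\<not> T y z" for x y z
    using that D(3)[of x y] D(3)[of y z] D(3)[of x z] B2[of x y z] B2[of z x y] B2[of y z x]
      B1[of z y x] B1[of x z y] B1[of y x z] tr[of x y z] tr[of z x y] tr[of y z x] sub(1)
    unfolding T_def by blast
  have op: "rel_op X D B (x, y) = (if T x y then y else x)" if "x \<in> X" "y \<in> X" for x y
    using that by (simp add: rel_op_def T_def)
  have ran: "rel_op X D B (x, y) \<in> X" if "x \<in> X" "y \<in> X" for x y
    using that by (simp add: op)
  \<comment> \<open>If \<open>T\<close> holds for exactly one of \<open>(a, b)\<close> and
    \<open>(b, c)\<close>, both sides agree by mere evaluation. Only the two uniform cases need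
    \<open>T1\<close> and \<open>T2\<close>.\<close>
  have "rel_op X D B (rel_op X D B (a, b), c) = rel_op X D B (a, rel_op X D B (b, c))"
    if "a \<in> X" "b \<in> X" "c \<in> X" for a b c
    using that T1[of a b c] T2[of a b c] by (auto simp: op)
  moreover have "rel_op X D B \<in> X \<times> X \<rightarrow>\<^sub>E X"
    using ran unfolding rel_op_def by (auto simp: PiE_iff extensional_def)
  moreover have "(x, y) \<in> D \<and> (y, x) \<in> D"
    if "x \<in> X" "y \<in> X" "rel_op X D B (x, y) \<noteq> rel_op X D B (y, x)" for x y
    using that D(3)[of x y] sub[of x y] sub[of y x] by (auto simp: op T_def split: if_splits)
  ultimately show ?thesis
    by (auto simp: commutes_outside_def quasitrivial_semigroups_def op)
qed

lemma bij_betw_right_rel: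
  assumes D: "D \<subseteq> X \<times> X" "trans D" "\<And>x y. x \<in> X \<Longrightarrow> y \<in> X \<Longrightarrow> (x, y) \<in> D \<or> (y, x) \<in> D"
  shows "bij_betw (right_rel D) (commutes_outside X D) {B. biclosed_rel D B}"
proof (rule bij_betw_byWitness[where f' = "rel_op X D"])
  show "\<forall>F\<in>commutes_outside X D. rel_op X D (right_rel D F) = F"
  proof
    fix F assume F: "F \<in> commutes_outside X D"
    have ext: "F \<in> extensional (X \<times> X)"
      and qt: "\<And>a b. a \<in> X \<Longrightarrow> b \<in> X \<Longrightarrow> F (a, b) = a \<or> F (a, b) = b"
      and co: "\<And>x y. x \<in> X \<Longrightarrow> y \<in> X \<Longrightarrow> F (x, y) \<noteq> F (y, x) \<Longrightarrow> (x, y) \<in> D \<and> (y, x) \<in> D"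
      using F by (auto simp: commutes_outside_def quasitrivial_semigroups_def PiE_iff)
    have "rel_op X D (right_rel D F) (x, y) = F (x, y)" if "x \<in> X" "y \<in> X" for x y
      using that qt[of x y] qt[of y x] co[of x y] D(3)[of x y]
      by (auto simp: rel_op_def right_rel_def)
    then show "rel_op X D (right_rel D F) = F"
      using ext by (intro extensionalityI[of _ "X \<times> X"]) (auto simp: rel_op_def)
  qed
  show "\<forall>B\<in>{B. biclosed_rel D B}. right_rel D (rel_op X D B) = B"
    using D(1) by (fastforce simp: biclosed_rel_def right_rel_def rel_op_def split: if_splits)
  show "right_rel D ` commutes_outside X D \<subseteq> {B. biclosed_rel D B}"
    using biclosed_right_rel[OF _ D(1,2)] by (auto simp: commutes_outside_def)
  show "rel_op X D ` {B. biclosed_rel D B} \<subseteq> commutes_outside X D"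
    using rel_op_commutes_outside[OF _ D] by auto
qed

section \<open>Roots as differences of weights\<close>

definition weight :: "(nat \<Rightarrow> 'v::real_vector) \<Rightarrow> nat \<Rightarrow> 'v" where
  "weight \<alpha> b = (\<Sum>i=1..<b. \<alpha> i)"

text \<open>The weights play the role of the coordinate vectors \<epsilon>, translated so that the
  first one is 0; this gives \<open>n + 1\<close> points in a space of dimension \<open>n\<close>.
  Positive roots are the pairs with \<open>a < b\<close>, negation swaps the entries, and composing
  pairs adds roots.\<close>

definition root_of :: "(nat \<Rightarrow> 'v::real_vector) \<Rightarrow> nat \<times> nat \<Rightarrow> 'v" where
  "root_of \<alpha> = (\<lambda>(a, b). weight \<alpha> b - weight \<alpha> a)"

lemma root_between_eq_root_of:
  assumes "1 \<le> j" "j \<le> k"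
  shows "root_between \<alpha> j k = root_of \<alpha> (j, k)"
  using sum.atLeastLessThan_concat[OF assms, of \<alpha>]
  by (simp add: root_between_def root_of_def weight_def algebra_simps)

lemma uminus_root_of: "- root_of \<alpha> (a, b) = root_of \<alpha> (b, a)"
  by (simp add: root_of_def)

lemma root_of_add: "root_of \<alpha> (a, b) + root_of \<alpha> (b, c) = root_of \<alpha> (a, c)"
  by (simp add: root_of_def)

lemma pos_roots_eq: "pos_roots \<alpha> n = root_of \<alpha> ` {(a, b). 1 \<le> a \<and> a < b \<and> b \<le> n + 1}"
proof (intro equalityI subsetI)
  fix x assume "x \<in> pos_roots \<alpha> n"
  then obtain i k where "1 \<le> i" "i \<le> k" "k \<le> n" "x = root_between \<alpha> i (k + 1)"
    by (auto simp: pos_roots_def)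
  then show "x \<in> root_of \<alpha> ` {(a, b). 1 \<le> a \<and> a < b \<and> b \<le> n + 1}"
    by (intro image_eqI[of _ _ "(i, k + 1)"]) (auto simp: root_between_eq_root_of)
next
  fix x assume "x \<in> root_of \<alpha> ` {(a, b). 1 \<le> a \<and> a < b \<and> b \<le> n + 1}"
  then obtain a b where ab: "1 \<le> a" "a < b" "b \<le> n + 1" "x = root_of \<alpha> (a, b)" by auto
  then have "x = root_between \<alpha> a (b - 1 + 1)" by (simp add: root_between_eq_root_of)
  then show "x \<in> pos_roots \<alpha> n"
    unfolding pos_roots_def using ab by (intro CollectI exI[of _ a] exI[of _ "b - 1"]) auto
qed

lemma root_system_A_eq: "root_system_A \<alpha> n = root_of \<alpha> ` ({1..n + 1} \<times> {1..n + 1} - Id)"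
proof -
  have "uminus ` pos_roots \<alpha> n = root_of \<alpha> ` {(a, b). 1 \<le> b \<and> b < a \<and> a \<le> n + 1}"
    unfolding pos_roots_eq by (force simp: uminus_root_of image_iff)
  moreover have "{1..n + 1} \<times> {1..n + 1} - Id =
      {(a, b). 1 \<le> a \<and> a < b \<and> b \<le> n + 1} \<union> {(a, b). 1 \<le> b \<and> b < a \<and> a \<le> n + 1}"
    by auto
  ultimately show ?thesis
    by (simp add: root_system_A_def pos_roots_eq image_Un)
qed

lemma linear_functional_exists:
  fixes \<alpha> :: "nat \<Rightarrow> 'v::real_vector" and g :: "nat \<Rightarrow> real"
  assumes "inj_on \<alpha> {1..n}" "independent (\<alpha> ` {1..n})"
  shows "\<exists>h. linear h \<and> (\<forall>i\<in>{1..n}. h (\<alpha> i) = g i)"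
proof -
  obtain h where "linear h" "\<forall>x\<in>\<alpha> ` {1..n}. h x = g (the_inv_into {1..n} \<alpha> x)"
    using linear_independent_extend[OF assms(2), of "\<lambda>x. g (the_inv_into {1..n} \<alpha> x)"] by auto
  then show ?thesis
    using assms(1) by (intro exI[of _ h]) (auto simp: the_inv_into_f_f)
qed

text \<open>Prescribing the increments of \<open>w\<close> on the simple roots makes the sums
  telescope. Hence arbitrary coordinates may be assigned to the \<open>n + 1\<close> points,
  although the weights themselves are linearly dependent.\<close>

lemma weight_functional_exists:
  fixes \<alpha> :: "nat \<Rightarrow> 'v::real_vector" and w :: "nat \<Rightarrow> real"
  assumes "inj_on \<alpha> {1..n}" "independent (\<alpha> ` {1..n})"
  shows "\<exists>h. linear h \<and>
    (\<forall>a\<in>{1..n + 1}. \<forall>b\<in>{1..n + 1}. h (root_of \<alpha> (a, b)) = w b - w a)"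
proof -
  obtain h where h: "linear h" "\<And>i. i \<in> {1..n} \<Longrightarrow> h (\<alpha> i) = w (Suc i) - w i"
    using linear_functional_exists[OF assms, of "\<lambda>i. w (Suc i) - w i"] by blast
  have "h (weight \<alpha> b) = w b - w 1" if "b \<in> {1..n + 1}" for b
  proof -
    have "h (weight \<alpha> b) = (\<Sum>i=1..<b. w (Suc i) - w i)"
      unfolding weight_def linear_sum[OF h(1)] using that by (intro sum.cong refl h(2)) auto
    also have "\<dots> = w b - w 1" using that by (intro sum_Suc_diff') auto
    finally show ?thesis .
  qed
  then show ?thesis
    using h(1) by (intro exI[of _ h]) (simp add: root_of_def linear_diff[OF h(1)])
qed

section \<open>Closed sets of roots as relations, and subsystems of intervals\<close>

context
  fixes \<alpha> :: "nat \<Rightarrow> 'v::real_vector" and n :: nat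
  assumes basis: "inj_on \<alpha> {1..n}" "independent (\<alpha> ` {1..n})"
begin

text \<open>The functional whose weights are the indicator of an index \<open>x\<close> counts the
  signed occurrences of \<open>x\<close> on both sides. Comparing these counts at all six indices
  leaves only composable pairs, in one of the two orders.\<close>

lemma root_of_add_cases:
  assumes X: "{a, b, c, d, e, f} \<subseteq> {1..n + 1}" and ne: "a \<noteq> b" "c \<noteq> d" "e \<noteq> f"
    and eq: "root_of \<alpha> (a, b) + root_of \<alpha> (c, d) = root_of \<alpha> (e, f)"
  shows "b = c \<and> e = a \<and> f = d \<or> d = a \<and> e = c \<and> f = b"
proof -
  have *: "of_bool (b = x) - of_bool (a = x) + (of_bool (d = x) - of_bool (c = x)) =
      (of_bool (f = x) - of_bool (e = x) :: real)" for x
  proof -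
    obtain h :: "'v \<Rightarrow> real" where h: "linear h" "\<And>a b. a \<in> {1..n + 1} \<Longrightarrow> b \<in> {1..n + 1} \<Longrightarrow>
        h (root_of \<alpha> (a, b)) = of_bool (b = x) - of_bool (a = x)"
      using weight_functional_exists[OF basis, of "\<lambda>b. of_bool (b = x)"] by blast
    show ?thesis
      using arg_cong[OF eq, of h] X by (simp add: linear_add[OF h(1)] h(2))
  qed
  show ?thesis
    using *[of a] *[of b] *[of c] *[of d] *[of e] *[of f] ne
    by (auto simp: of_bool_def split: if_splits)
qed

lemma inj_on_root_of: "inj_on (root_of \<alpha>) ({1..n + 1} \<times> {1..n + 1} - Id)"
proof (rule inj_onI, unfold split_paired_all)
  fix a b c d :: nat
  assume "(a, b) \<in> {1..n + 1} \<times> {1..n + 1} - Id" "(c, d) \<in> {1..n + 1} \<times> {1..n + 1} - Id"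
    and eq: "root_of \<alpha> (a, b) = root_of \<alpha> (c, d)"
  then have X: "a \<in> {1..n + 1}" "b \<in> {1..n + 1}" "c \<in> {1..n + 1}" "d \<in> {1..n + 1}"
    and ne: "a \<noteq> b" "c \<noteq> d" by auto
  have *: "of_bool (b = x) - of_bool (a = x) = (of_bool (d = x) - of_bool (c = x) :: real)" for x
  proof -
    obtain h :: "'v \<Rightarrow> real" where h: "linear h" "\<And>a b. a \<in> {1..n + 1} \<Longrightarrow> b \<in> {1..n + 1} \<Longrightarrow>
        h (root_of \<alpha> (a, b)) = of_bool (b = x) - of_bool (a = x)"
      using weight_functional_exists[OF basis, of "\<lambda>b. of_bool (b = x)"] by blast
    show ?thesis
      using arg_cong[OF eq, of h] X by (simp add: h(2))
  qed
  show "(a, b) = (c, d)"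
    using *[of a] *[of b] ne by (auto simp: of_bool_def split: if_splits)
qed

lemma root_of_mem_image_iff:
  assumes "C \<subseteq> {1..n + 1} \<times> {1..n + 1} - Id" "a \<in> {1..n + 1}" "b \<in> {1..n + 1}" "a \<noteq> b"
  shows "root_of \<alpha> (a, b) \<in> root_of \<alpha> ` C \<longleftrightarrow> (a, b) \<in> C"
  using inj_on_image_mem_iff[OF inj_on_root_of _ assms(1)] assms by auto

text \<open>Sums of roots that are roots correspond exactly to compositions of pairs with distinct
  ends. The reflexive closure excuses \<open>(x, y)\<close> and \<open>(y, x)\<close>: their roots
  are opposite, and the sum 0 is not a root.\<close>

lemma closed_roots_image_iff:
  assumes C: "C \<subseteq> {1..n + 1} \<times> {1..n + 1} - Id"
  shows "closed_roots (root_system_A \<alpha> n) (root_of \<alpha> ` C) \<longleftrightarrow> trans (C\<^sup>=)"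
proof
  assume cl: "closed_roots (root_system_A \<alpha> n) (root_of \<alpha> ` C)"
  have "(x, z) \<in> C" if "(x, y) \<in> C" "(y, z) \<in> C" "x \<noteq> z" for x y z
  proof -
    have "x \<in> {1..n + 1}" "z \<in> {1..n + 1}" using that C by auto
    moreover from this have "root_of \<alpha> (x, y) + root_of \<alpha> (y, z) \<in> root_system_A \<alpha> n"
      using that(3) unfolding root_of_add root_system_A_eq by (intro imageI) auto
    then have "root_of \<alpha> (x, y) + root_of \<alpha> (y, z) \<in> root_of \<alpha> ` C"
      using cl that(1,2) by (auto simp: closed_roots_def)
    then have "root_of \<alpha> (x, z) \<in> root_of \<alpha> ` C" by (simp add: root_of_add)
    ultimately show ?thesis using root_of_mem_image_iff[OF C] that(3) by blast
  qed
  then show "trans (C\<^sup>=)" unfolding trans_def by blast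
next
  assume tr: "trans (C\<^sup>=)"
  show "closed_roots (root_system_A \<alpha> n) (root_of \<alpha> ` C)"
    unfolding closed_roots_def
  proof (intro conjI ballI impI)
    show "root_of \<alpha> ` C \<subseteq> root_system_A \<alpha> n" using C by (auto simp: root_system_A_eq)
    fix x y assume "x \<in> root_of \<alpha> ` C" "y \<in> root_of \<alpha> ` C" and s: "x + y \<in> root_system_A \<alpha> n"
    then obtain a b c d where xy: "(a, b) \<in> C" "(c, d) \<in> C"
      "x = root_of \<alpha> (a, b)" "y = root_of \<alpha> (c, d)" by auto
    obtain e f where ef: "e \<in> {1..n + 1}" "f \<in> {1..n + 1}" "e \<noteq> f" "x + y = root_of \<alpha> (e, f)"
      using s unfolding root_system_A_eq by blast
    have "b = c \<and> e = a \<and> f = d \<or> d = a \<and> e = c \<and> f = b"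
      using xy ef C by (intro root_of_add_cases) auto
    then have "(e, f) \<in> C" using tr xy(1,2) ef(3) unfolding trans_def by blast
    then show "x + y \<in> root_of \<alpha> ` C" using ef(4) by simp
  qed
qed

lemma bij_betw_image_root_of:
  assumes D: "D \<subseteq> {1..n + 1} \<times> {1..n + 1}"
  shows "bij_betw (image (root_of \<alpha>)) {B. biclosed_rel D B}
    {B. biclosed_in (root_system_A \<alpha> n) (root_of \<alpha> ` (D - Id)) B}"
proof -
  let ?r = "root_of \<alpha>" and ?D = "D - Id"
  have inj: "inj_on ?r ?D" using D by (intro inj_on_subset[OF inj_on_root_of]) auto
  have *: "biclosed_in (root_system_A \<alpha> n) (?r ` ?D) (?r ` B) \<longleftrightarrow> biclosed_rel D B"
    if B: "B \<subseteq> ?D" for B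
  proof -
    have "?r ` ?D - ?r ` B = ?r ` (?D - B)"
      using inj_on_image_set_diff[OF inj _ B] by auto
    \<comment> \<open>The diagonal of \<open>D\<close> carries no roots; the reflexive closure
      absorbs it.\<close>
    moreover have "(?D - B)\<^sup>= = (D - B)\<^sup>=" by auto
    moreover have "B \<subseteq> {1..n + 1} \<times> {1..n + 1} - Id" "?D - B \<subseteq> {1..n + 1} \<times> {1..n + 1} - Id"
      using B D by auto
    ultimately show ?thesis
      using B closed_roots_image_iff[of B] closed_roots_image_iff[of "?D - B"]
      unfolding biclosed_in_def biclosed_rel_def by (auto intro!: imageI)
  qed
  have "inj_on (image ?r) (Pow ?D)" using inj by (rule inj_on_image_Pow)
  then have "inj_on (image ?r) {B. biclosed_rel D B}"
    by (rule inj_on_subset) (auto simp: biclosed_rel_def)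
  moreover have "image ?r ` {B. biclosed_rel D B} =
      {B. biclosed_in (root_system_A \<alpha> n) (?r ` ?D) B}"
  proof (intro equalityI subsetI)
    fix B assume "B \<in> image ?r ` {B. biclosed_rel D B}"
    then obtain B' where "B = ?r ` B'" "biclosed_rel D B'" by auto
    then show "B \<in> {B. biclosed_in (root_system_A \<alpha> n) (?r ` ?D) B}"
      using *[of B'] by (simp add: biclosed_rel_def)
  next
    fix B assume B: "B \<in> {B. biclosed_in (root_system_A \<alpha> n) (?r ` ?D) B}"
    then obtain B' where "B' \<subseteq> ?D" "B = ?r ` B'"
      by (auto simp: biclosed_in_def subset_image_iff)
    then show "B \<in> image ?r ` {B. biclosed_rel D B}" using B *[of B'] by auto
  qed
  ultimately show ?thesis by (rule bij_betw_imageI)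
qed

lemma root_of_in_span_iff:
  assumes ab: "1 \<le> a" "a < b" "b \<le> n + 1" and pq: "1 \<le> p" "q \<le> n"
  shows "root_of \<alpha> (a, b) \<in> span (\<alpha> ` {p..q}) \<longleftrightarrow> p \<le> a \<and> b \<le> q + 1"
proof
  assume span: "root_of \<alpha> (a, b) \<in> span (\<alpha> ` {p..q})"
  have "i \<in> {p..q}" if i: "i \<in> {a..<b}" for i
  proof (rule ccontr)
    assume out: "i \<notin> {p..q}"
    \<comment> \<open>The functional reading off the coefficient of \<open>\<alpha> i\<close>: it
      vanishes on the span, yet is 1 on the root because \<open>i\<close> lies in its
      support.\<close>
    obtain h :: "'v \<Rightarrow> real" where h: "linear h"
      "\<And>j. j \<in> {1..n} \<Longrightarrow> h (\<alpha> j) = of_bool (j = i)"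
      using linear_functional_exists[OF basis, of "\<lambda>j. of_bool (j = i)"] by blast
    have "h x = 0" if "x \<in> \<alpha> ` {p..q}" for x
      using that out pq h(2) by auto
    then have "h (root_of \<alpha> (a, b)) = 0"
      using linear_eq_0_on_span[OF h(1) _ span] by blast
    moreover have "h (root_of \<alpha> (a, b)) = (\<Sum>j=a..<b. h (\<alpha> j))"
      using ab by (simp add: root_between_eq_root_of[symmetric] root_between_def linear_sum[OF h(1)])
    moreover have "\<dots> = (\<Sum>j=a..<b. of_bool (j = i))"
      using ab by (intro sum.cong refl h(2)) auto
    ultimately show False using i by (simp add: of_bool_def)
  qed
  \<comment> \<open>The support is \<open>{a..<b}\<close>, so its first and last indices are
    \<open>a\<close> and \<open>b - 1\<close>.\<close>
  from this[of a] this[of "b - 1"] ab show "p \<le> a \<and> b \<le> q + 1" by fastforce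
next
  assume "p \<le> a \<and> b \<le> q + 1"
  then show "root_of \<alpha> (a, b) \<in> span (\<alpha> ` {p..q})"
    using ab unfolding root_between_eq_root_of[OF ab(1) less_imp_le[OF ab(2)], symmetric] root_between_def
    by (intro span_sum span_base imageI) auto
qed

text \<open>The upper end moves to \<open>q + 1\<close> because \<open>\<alpha> q\<close> is the
  root of the pair \<open>(q, q + 1)\<close>. Negative roots reduce to positive ones, as a span is
  closed under negation.\<close>

lemma subsystem_interval_eq:
  assumes pq: "1 \<le> p" "q \<le> n"
  shows "subsystem \<alpha> n (\<alpha> ` {p..q}) = root_of \<alpha> ` ({p..q + 1} \<times> {p..q + 1} - Id)"
proof -
  have "root_of \<alpha> (a, b) \<in> span (\<alpha> ` {p..q}) \<longleftrightarrow> a \<in> {p..q + 1} \<and> b \<in> {p..q + 1}"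
    if "a \<in> {1..n + 1}" "b \<in> {1..n + 1}" "a \<noteq> b" for a b
  proof (cases "a < b")
    case True
    then show ?thesis using root_of_in_span_iff[OF _ _ _ pq, of a b] that by auto
  next
    case False
    moreover have "root_of \<alpha> (a, b) \<in> span (\<alpha> ` {p..q}) \<longleftrightarrow> root_of \<alpha> (b, a) \<in> span (\<alpha> ` {p..q})"
      by (metis span_neg uminus_root_of)
    ultimately show ?thesis using root_of_in_span_iff[OF _ _ _ pq, of b a] that by auto
  qed
  then show ?thesis
    unfolding subsystem_def root_system_A_eq using pq by (fastforce simp: image_iff)
qed

end

section \<open>The preorder of the parabolic subset\<close>

definition same_block :: "nat \<Rightarrow> (nat \<Rightarrow> nat) \<Rightarrow> (nat \<Rightarrow> nat) \<Rightarrow> nat \<Rightarrow> nat \<Rightarrow> bool" where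
  "same_block m p t a b \<longleftrightarrow>
    (\<exists>i\<in>{1..m}. a \<in> {p i..p i + t i + 1} \<and> b \<in> {p i..p i + t i + 1})"

text \<open>The pairs with \<open>a < b\<close> give the positive roots, and those in a common block
  add the negative roots of the subsystem. The diagonal is kept so that the relation is a total
  preorder.\<close>

definition block_preorder :: "nat \<Rightarrow> nat \<Rightarrow> (nat \<Rightarrow> nat) \<Rightarrow> (nat \<Rightarrow> nat) \<Rightarrow> nat rel" where
  "block_preorder n m p t =
    {(a, b) \<in> {1..n + 1} \<times> {1..n + 1}. a \<le> b \<or> same_block m p t a b}"

text \<open>Blocks are intervals: if one step goes up and the other goes down inside a block, then
  either the ends are in order or convexity puts both into that block. Two downward steps share the
  middle point, so by disjointness they use the same block.\<close>

lemma trans_block_preorder: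
  assumes dis: "\<And>i i' x. i \<in> {1..m} \<Longrightarrow> i' \<in> {1..m} \<Longrightarrow> x \<in> {p i..p i + t i + 1} \<Longrightarrow>
    x \<in> {p i'..p i' + t i' + 1} \<Longrightarrow> i = i'"
  shows "trans (block_preorder n m p t)"
proof (rule transI)
  fix a b c assume ab: "(a, b) \<in> block_preorder n m p t" and bc: "(b, c) \<in> block_preorder n m p t"
  have "a \<le> c \<or> same_block m p t a c"
  proof (cases "a \<le> b")
    case True
    with bc show ?thesis by (fastforce simp: block_preorder_def same_block_def)
  next
    case False
    then obtain i where i: "i \<in> {1..m}" "a \<in> {p i..p i + t i + 1}" "b \<in> {p i..p i + t i + 1}"
      using ab by (auto simp: block_preorder_def same_block_def)
    show ?thesis
    proof (cases "b \<le> c")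
      case True
      with i show ?thesis by (auto simp: same_block_def intro!: bexI[of _ i])
    next
      case False
      then obtain i' where i': "i' \<in> {1..m}" "b \<in> {p i'..p i' + t i' + 1}" "c \<in> {p i'..p i' + t i' + 1}"
        using bc by (auto simp: block_preorder_def same_block_def)
      then show ?thesis using i dis[OF i(1) i'(1) i(3) i'(2)] by (auto simp: same_block_def)
    qed
  qed
  then show "(a, c) \<in> block_preorder n m p t"
    using ab bc by (auto simp: block_preorder_def)
qed

text \<open>Distinct points are equivalent exactly when \<open>F\<close> does not commute on them,
  so the condition on classes can be tested on pairs.\<close>

lemma block_quasitrivial_semigroups_eq:
  assumes dis: "\<And>i i' x. i \<in> {1..m} \<Longrightarrow> i' \<in> {1..m} \<Longrightarrow> x \<in> {p i..p i + t i + 1} \<Longrightarrow>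
    x \<in> {p i'..p i' + t i' + 1} \<Longrightarrow> i = i'"
  shows "block_quasitrivial_semigroups n m p t =
    commutes_outside {1..n + 1} (block_preorder n m p t)"
proof -
  let ?X = "{1..n + 1}"
  have classes: "(\<forall>E\<in>qt_classes ?X F. \<not> is_singleton E \<longrightarrow> (\<exists>i\<in>{1..m}. E \<subseteq> {p i..p i + t i + 1})) \<longleftrightarrow>
    (\<forall>x\<in>?X. \<forall>y\<in>?X. F (x, y) \<noteq> F (y, x) \<longrightarrow> same_block m p t x y)" (is "?L \<longleftrightarrow> ?R")
    if F: "F \<in> quasitrivial_semigroups ?X" for F
  proof -
    have qt: "F (a, b) = a \<or> F (a, b) = b" if "a \<in> ?X" "b \<in> ?X" for a b
      using F that by (auto simp: quasitrivial_semigroups_def)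
    define S where "S = qt_preorder ?X F \<inter> (qt_preorder ?X F)\<inverse>"
    have S: "(x, y) \<in> S \<longleftrightarrow> x \<in> ?X \<and> y \<in> ?X \<and> (x = y \<or> F (x, y) \<noteq> F (y, x))" for x y
      using qt[of x y] qt[of y x]
      unfolding S_def represents_unique[OF qt_preorder_represents[OF F]] by auto
    show ?thesis
    proof
      assume L: ?L
      show ?R
      proof (intro ballI impI)
        fix x y assume xy: "x \<in> ?X" "y \<in> ?X" "F (x, y) \<noteq> F (y, x)"
        have "S `` {x} \<in> qt_classes ?X F"
          unfolding qt_classes_def S_def[symmetric] using xy(1) by (rule quotientI)
        moreover have xyS: "x \<in> S `` {x}" "y \<in> S `` {x}" using xy S by auto
        moreover have "x \<noteq> y" using xy by auto
        then have "\<not> is_singleton (S `` {x})" using xyS by (metis is_singletonE singletonD)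
        ultimately show "same_block m p t x y" using L unfolding same_block_def by blast
      qed
    next
      assume R: ?R
      show ?L
      proof (intro ballI impI)
        fix E assume E: "E \<in> qt_classes ?X F" "\<not> is_singleton E"
        obtain x where x: "x \<in> ?X" "E = S `` {x}"
          using E(1) unfolding qt_classes_def S_def[symmetric] by (rule quotientE)
        have xE: "x \<in> E" using x S by auto
        then obtain y where y: "y \<in> E" "y \<noteq> x" using E(2) by (metis is_singletonI' empty_iff)
        have sb: "same_block m p t x z" if "z \<in> E" "z \<noteq> x" for z
          using that x R S by (metis Image_singleton_iff)
        obtain i where i: "i \<in> {1..m}" "x \<in> {p i..p i + t i + 1}"
          using sb[OF y] by (auto simp: same_block_def)
        \<comment> \<open>Each pair \<open>x\<close>, \<open>z\<close> comes with its own block;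
          disjointness makes it the one block containing \<open>x\<close>.\<close>
        have "z \<in> {p i..p i + t i + 1}" if "z \<in> E" for z
          using sb[OF that] dis[OF i(1) _ i(2)] i unfolding same_block_def by blast
        then show "\<exists>i\<in>{1..m}. E \<subseteq> {p i..p i + t i + 1}" using i(1) by blast
      qed
    qed
  qed
  \<comment> \<open>For distinct points, one of the two orders violates \<open><=\<close>, so lying
    in the preorder both ways means sharing a block.\<close>
  have block: "(\<forall>x\<in>?X. \<forall>y\<in>?X. F (x, y) \<noteq> F (y, x) \<longrightarrow> same_block m p t x y) \<longleftrightarrow>
      (\<forall>x\<in>?X. \<forall>y\<in>?X. F (x, y) \<noteq> F (y, x) \<longrightarrow>
        (x, y) \<in> block_preorder n m p t \<and> (y, x) \<in> block_preorder n m p t)" for F :: "nat \<times> nat \<Rightarrow> nat"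
  proof (intro ball_cong refl imp_cong)
    fix x y assume "x \<in> ?X" "y \<in> ?X" "F (x, y) \<noteq> F (y, x)"
    then show "same_block m p t x y \<longleftrightarrow>
        (x, y) \<in> block_preorder n m p t \<and> (y, x) \<in> block_preorder n m p t"
      by (cases "x = y") (auto simp: block_preorder_def same_block_def)
  qed
  show ?thesis
    unfolding block_quasitrivial_semigroups_def commutes_outside_def
    by (rule Collect_cong, rule conj_cong[OF refl], rule trans[OF classes block])
qed

section \<open>The bijection and its explicit description\<close>

theorem theorem4p3:
  fixes \<alpha> :: "nat \<Rightarrow> 'v::real_vector"
    and n m :: nat and p t :: "nat \<Rightarrow> nat"
    and \<Delta>2i :: "nat \<Rightarrow> 'v set" and \<Delta>2 :: "'v set"
  assumes "n \<ge> 1"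
    and basis: "inj_on \<alpha> {1..n}" "independent (\<alpha> ` {1..n})" "span (\<alpha> ` {1..n}) = UNIV"
    and range: "\<And>i. i \<in> {1..m} \<Longrightarrow> 1 \<le> p i \<and> p i + t i \<le> n"
    and blocks: "\<And>i. i \<in> {1..m} \<Longrightarrow> \<Delta>2i i = \<alpha> ` {p i..p i + t i}"
    and union: "\<Delta>2 = (\<Union>i\<in>{1..m}. \<Delta>2i i)"
    and gaps: "\<And>i i'. i \<in> {1..m} \<Longrightarrow> i' \<in> {1..m} \<Longrightarrow> i \<noteq> i' \<Longrightarrow>
        \<bar>int (p i + t i) - int (p i')\<bar> \<ge> 2"
    and disjoint: "\<And>i i'. i \<in> {1..m} \<Longrightarrow> i' \<in> {1..m} \<Longrightarrow> i \<noteq> i' \<Longrightarrow>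
        subsystem \<alpha> n (\<Delta>2i i) \<inter> subsystem \<alpha> n (\<Delta>2i i') = {}"
    and union_subsystems: "(\<Union>i\<in>{1..m}. subsystem \<alpha> n (\<Delta>2i i)) = subsystem \<alpha> n \<Delta>2"
  shows "\<exists>\<Theta>.
    bij_betw \<Theta> (block_quasitrivial_semigroups n m p t)
      {B. biclosed_in (root_system_A \<alpha> n) (std_parabolic \<alpha> n \<Delta>2) B} \<and>
    (\<forall>F \<in> block_quasitrivial_semigroups n m p t. \<forall>j k. 1 \<le> j \<and> j \<le> k \<and> k \<le> n \<longrightarrow>
      (let \<beta> = root_between \<alpha> j (k + 1);
           same_block = (\<exists>i\<in>{1..m}. j \<in> {p i..p i + t i + 1} \<and> k + 1 \<in> {p i..p i + t i + 1})
       in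
        (F (j, k + 1) = j \<and> F (k + 1, j) = k + 1 \<longrightarrow> {\<beta>, - \<beta>} \<inter> \<Theta> F = {}) \<and>
        (F (j, k + 1) = k + 1 \<and> F (k + 1, j) = k + 1 \<longrightarrow> \<beta> \<in> \<Theta> F \<and> - \<beta> \<notin> \<Theta> F) \<and>
        (F (j, k + 1) = j \<and> F (k + 1, j) = j \<and> same_block \<longrightarrow> - \<beta> \<in> \<Theta> F \<and> \<beta> \<notin> \<Theta> F) \<and>
        (F (j, k + 1) = k + 1 \<and> F (k + 1, j) = j \<longrightarrow> {\<beta>, - \<beta>} \<subseteq> \<Theta> F) \<and>
        (F (j, k + 1) = j \<and> F (k + 1, j) = j \<and> \<not> same_block \<longrightarrow> {\<beta>, - \<beta>} \<inter> \<Theta> F = {})))"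
proof -
  have blocks': "\<Delta>2i i = \<alpha> ` {p i..p i + t i}" "1 \<le> p i" "p i + t i \<le> n" if "i \<in> {1..m}" for i
    using blocks range that by auto
  have sub: "subsystem \<alpha> n (\<Delta>2i i) =
      root_of \<alpha> ` ({p i..p i + t i + 1} \<times> {p i..p i + t i + 1} - Id)" if "i \<in> {1..m}" for i
    using subsystem_interval_eq[OF basis(1,2) blocks'(2,3)[OF that]] blocks'(1)[OF that] by simp
  have dis: "i = i'" if "i \<in> {1..m}" "i' \<in> {1..m}" "x \<in> {p i..p i + t i + 1}"
    "x \<in> {p i'..p i' + t i' + 1}" for i i' x
  proof (rule ccontr)
    assume ne: "i \<noteq> i'"
    have "\<not> (y \<in> {p i..p i + t i} \<and> y \<in> {p i'..p i' + t i'})" for y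
    proof
      \<comment> \<open>A common index \<open>y\<close> would give the common simple root
        \<open>\<alpha> y\<close>, which is the root of \<open>(y, y + 1)\<close>.\<close>
      assume "y \<in> {p i..p i + t i} \<and> y \<in> {p i'..p i' + t i'}"
      then have "root_of \<alpha> (y, y + 1) \<in> subsystem \<alpha> n (\<Delta>2i i) \<inter> subsystem \<alpha> n (\<Delta>2i i')"
        using that(1,2) by (auto simp: sub)
      then show False using disjoint[OF that(1,2) ne] by blast
    qed
    \<comment> \<open>Disjoint intervals of simple roots are ordered, and the gap of at least 2
      leaves room for the extra point at the right end of the earlier block.\<close>
    from this[of "p i"] this[of "p i'"] show False
      using gaps[OF that(1,2) ne] gaps[OF that(2,1) ne[symmetric]] that(3,4) by auto
  qed
  define D where "D = block_preorder n m p t"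
  have D: "D \<subseteq> {1..n + 1} \<times> {1..n + 1}" by (auto simp: D_def block_preorder_def)
  have "subsystem \<alpha> n \<Delta>2 = root_of \<alpha> ` ({(a, b). same_block m p t a b} - Id)"
    unfolding union_subsystems[symmetric] by (force simp: sub same_block_def)
  moreover have "D - Id = {(a, b). 1 \<le> a \<and> a < b \<and> b \<le> n + 1} \<union> ({(a, b). same_block m p t a b} - Id)"
    using range by (fastforce simp: D_def block_preorder_def same_block_def)
  ultimately have par: "std_parabolic \<alpha> n \<Delta>2 = root_of \<alpha> ` (D - Id)"
    by (simp add: std_parabolic_def pos_roots_eq image_Un)
  have semigroups: "block_quasitrivial_semigroups n m p t = commutes_outside {1..n + 1} D"
    unfolding D_def using dis by (rule block_quasitrivial_semigroups_eq)
  have "bij_betw (right_rel D) (commutes_outside {1..n + 1} D) {B. biclosed_rel D B}"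
  proof (rule bij_betw_right_rel[OF D])
    show "trans D" unfolding D_def using dis by (rule trans_block_preorder)
    show "(x, y) \<in> D \<or> (y, x) \<in> D" if "x \<in> {1..n + 1}" "y \<in> {1..n + 1}" for x y
      using that by (auto simp: D_def block_preorder_def)
  qed
  from bij_betw_trans[OF this bij_betw_image_root_of[OF basis(1,2) D]]
  \<comment> \<open>The bijection sends \<open>F\<close> to the roots of all pairs
    \<open>(a, b)\<close> in \<open>D\<close> with \<open>a\<close> and \<open>b\<close> distinct
    and \<open>F (a, b) = b\<close>.\<close>
  have bij: "bij_betw (image (root_of \<alpha>) \<circ> right_rel D) (block_quasitrivial_semigroups n m p t)
      {B. biclosed_in (root_system_A \<alpha> n) (std_parabolic \<alpha> n \<Delta>2) B}"
    unfolding par semigroups .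
  have mem: "root_of \<alpha> (a, b) \<in> (image (root_of \<alpha>) \<circ> right_rel D) F \<longleftrightarrow> (a, b) \<in> D \<and> F (a, b) = b"
    if "a \<in> {1..n + 1}" "b \<in> {1..n + 1}" "a \<noteq> b" for a b F
    using root_of_mem_image_iff[OF basis(1,2) _ that, of "right_rel D F"] that D
    by (auto simp: right_rel_def)
  have inD: "(j, k + 1) \<in> D \<and> ((k + 1, j) \<in> D \<longleftrightarrow> same_block m p t j (k + 1))"
    if "1 \<le> j" "j \<le> k" "k \<le> n" for j k
    using that by (auto simp: D_def block_preorder_def same_block_def)
  show ?thesis
  proof (rule exI, rule conjI[OF bij], intro ballI allI impI, goal_cases)
    case (1 F j k)
    then have "root_between \<alpha> j (k + 1) = root_of \<alpha> (j, k + 1)"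
      by (intro root_between_eq_root_of) auto
    moreover have "root_of \<alpha> (j, k + 1) \<in> (image (root_of \<alpha>) \<circ> right_rel D) F \<longleftrightarrow> F (j, k + 1) = k + 1"
      "root_of \<alpha> (k + 1, j) \<in> (image (root_of \<alpha>) \<circ> right_rel D) F \<longleftrightarrow>
        same_block m p t j (k + 1) \<and> F (k + 1, j) = j"
      using 1 inD[of j k] mem[of j "k + 1" F] mem[of "k + 1" j F] by auto
    moreover have "j \<noteq> k + 1" using 1 by auto
    \<comment> \<open>Case (d) does not assume a common block; noncommutativity supplies it, which
      puts the negative root into the image.\<close>
    moreover have "same_block m p t j (k + 1)" if "F (j, k + 1) \<noteq> F (k + 1, j)"
      using 1 that inD[of j k] unfolding semigroups commutes_outside_def by auto
    ultimately show ?case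
      unfolding Let_def same_block_def[symmetric] by (simp add: uminus_root_of del: comp_apply)
  qed
qed

end
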